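(* There exists an absolute constant $c>0$ such that the following holds. Let $d\ge1$, $n\ge1$, and let $v_1,\dots,v_n\in\mathbb{R}^d$ be unit vectors with $\langle v_i,v_j\rangle\ge -0.9$ for all $i\neq j$. Let $g\sim\mathcal{N}(0,I_d)$, $X_i=\mathrm{sgn}(\langle g,v_i\rangle)$ and $X=\sum_{i=1}^n X_i$. Then \[ \mathbb{E}[X^2]\ \ge\ n^2\cdot 2^{-c\,d}. \]
   Context: $\mathcal{N}(0,I_d)$ is the standard Gaussian distribution on $\mathbb{R}^d$; $\mathrm{sgn}(t)\in\{\pm1\}$ is the sign of $t$ (the value at $t=0$ is irrelevant since it occurs with probability $0$). *)

theory Defs
  imports "HOL-Probability.Probability"
begin

text \<open>
  Vectors in \<open>d\<close>-dimensional Euclidean space are functions \<open>nat \<Rightarrow> real\<close> of which only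
  the coordinates \<open>k < d\<close> matter. The dimension is thus a term, so that a constant can be
  quantified before it; an index type would let the constant depend on the dimension.
  The Euclidean norm is \<open>L2_set v {..<d}\<close>.
\<close>

definition dot :: "nat \<Rightarrow> (nat \<Rightarrow> real) \<Rightarrow> (nat \<Rightarrow> real) \<Rightarrow> real" where
  "dot d x y = (\<Sum>k<d. x k * y k)"

definition std_gaussian :: "nat \<Rightarrow> (nat \<Rightarrow> real) measure" where
  "std_gaussian d = (\<Pi>\<^sub>M k\<in>{..<d}. density lborel (\<lambda>x. ennreal (std_normal_density x)))"

text \<open>Unlike the library's \<^const>\<open>sgn\<close>, this sign takes values in \<open>{-1, 1}\<close> also at \<open>0\<close>.\<close>

definition pm_sgn :: "real \<Rightarrow> real" where
  "pm_sgn t = (if t < 0 then - 1 else 1)"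

end

theory Submission
  imports Defs
begin

text \<open>
  By pigeonhole over a grid of mesh of order \<open>1 / sqrt d\<close>, some \<open>v j\<close> has inner product at least
  \<open>0.95\<close> with a fraction \<open>128\<^sup>-\<^sup>d\<close> of the vectors. The random variable \<open>X\<close> is tested
  against \<open>Y = sin (r * \<langle>g, v j\<rangle>)\<close> with \<open>r\<close> of order \<open>sqrt d\<close>: since \<open>\<bar>Y\<bar> \<le> 1\<close>, the
  second moment of \<open>X\<close> is at least the square of the expectation of \<open>X * Y\<close>. The Dirichlet integral
  writes the sign of \<open>\<langle>g, u\<rangle>\<close> as \<open>2 / pi\<close> times the improper integral of \<open>sin (s * \<langle>g, u\<rangle>) / s\<close>,
  and the Gaussian characteristic function then gives
  \<open>E[sgn \<langle>g, u\<rangle> * sin (r * \<langle>g, w\<rangle>)] = (2 / pi) * \<integral>\<^sub>0\<^sup>\<infinity> exp (- (s\<^sup>2 + r\<^sup>2) / 2) * sinh (s * r * \<langle>u, w\<rangle>) / s ds\<close>.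
  The hyperbolic sine amplifies the gap between the inner products \<open>0.95\<close> and \<open>-0.9\<close> to
  \<open>exp (0.05 * s * r)\<close>, which beats the factor \<open>128\<^sup>d\<close> once \<open>s * r\<close> is a large multiple of \<open>d\<close>.
\<close>

section \<open>Gaussian expectations of linear functionals\<close>

lemma dot_measurable [measurable]: "(\<lambda>g. dot d g z) \<in> borel_measurable (std_gaussian d)"
  unfolding dot_def std_gaussian_def by measurable

lemma prob_space_std_gaussian: "prob_space (std_gaussian d)"
  unfolding std_gaussian_def
  by (intro prob_space_PiM prob_space_normal_density) simp

lemma integral_iexp_dot:
  "(CLINT g|std_gaussian d. iexp (dot d g z)) = exp (- (dot d z z / 2))"
proof -
  interpret N: real_distribution std_normal_distribution by (rule real_dist_normal_dist)
  interpret product_prob_space "\<lambda>_. std_normal_distribution" "{..<d}" ..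
  have "(CLINT g|std_gaussian d. iexp (dot d g z)) =
    (CLINT g|std_gaussian d. (\<Prod>k<d. iexp (z k * g k)))"
    by (simp add: dot_def sum_distrib_left mult.commute flip: exp_sum)
  also have "\<dots> = (\<Prod>k<d. char std_normal_distribution (z k))"
    unfolding std_gaussian_def char_def
    by (rule product_integral_prod) (auto intro!: N.integrable_iexp)
  also have "\<dots> = exp (- (dot d z z / 2))"
    by (simp add: char_std_normal_distribution dot_def sum_divide_distrib power2_eq_square
        flip: exp_sum of_real_prod sum_negf)
  finally show ?thesis .
qed

lemma integral_cos_dot:
  "prob_space.expectation (std_gaussian d) (\<lambda>g. cos (dot d g z)) = exp (- (dot d z z / 2))"
proof -
  interpret prob_space "std_gaussian d" by (rule prob_space_std_gaussian)
  have "expectation (\<lambda>g. cos (dot d g z)) = expectation (\<lambda>g. Re (iexp (dot d g z)))"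
    by (simp add: Re_exp)
  also have "\<dots> = Re (CLINT g|std_gaussian d. iexp (dot d g z))"
    by (intro integral_Re integrable_iexp) auto
  finally show ?thesis by (simp add: integral_iexp_dot Re_exp)
qed

lemma dot_lincomb: "dot d g (\<lambda>k. s * u k + r * w k) = s * dot d g u + r * dot d g w"
  by (simp add: dot_def sum.distrib sum_distrib_left algebra_simps)

lemma dot_lincomb_left: "dot d (\<lambda>k. s * u k + r * w k) g = s * dot d u g + r * dot d w g"
  by (simp add: dot_def sum.distrib sum_distrib_left algebra_simps)

lemma dot_commute: "dot d u w = dot d w u"
  by (simp add: dot_def mult.commute)

text \<open>The product-to-sum formula leaves cosines of the functionals along
  \<open>s u - r w\<close> and \<open>s u + r w\<close>. Their squared norms differ only in the sign
  of the cross term \<open>2 * s * r * dot d u w\<close>, so the two Gaussian factors combine into a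
  \<open>sinh\<close>.\<close>

lemma integral_sin_sin_dot:
  assumes "dot d u u = 1" "dot d w w = 1"
  shows "prob_space.expectation (std_gaussian d) (\<lambda>g. sin (s * dot d g u) * sin (r * dot d g w)) =
    exp (- ((s\<^sup>2 + r\<^sup>2) / 2)) * sinh (s * r * dot d u w)"
proof -
  interpret prob_space "std_gaussian d" by (rule prob_space_std_gaussian)
  have int: "integrable (std_gaussian d) (\<lambda>g. cos (dot d g z))" for z
    by (rule integrable_const_bound[where B=1]) auto
  let ?z = "\<lambda>r k. s * u k + r * w k"
  have norm: "dot d (?z r) (?z r) = s\<^sup>2 + r\<^sup>2 + 2 * s * r * dot d u w" for r
    by (simp only: dot_lincomb dot_lincomb_left assms dot_commute[of d w u])
      (simp add: algebra_simps power2_eq_square)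
  have "expectation (\<lambda>g. sin (s * dot d g u) * sin (r * dot d g w)) =
    expectation (\<lambda>g. (cos (dot d g (?z (-r))) - cos (dot d g (?z r))) / 2)"
    by (simp only: dot_lincomb sin_times_sin) simp
  also have "\<dots> = (exp (- (dot d (?z (-r)) (?z (-r)) / 2)) - exp (- (dot d (?z r) (?z r) / 2))) / 2"
    using int by (simp add: integral_cos_dot del: mult_minus_left)
  also have "\<dots> = exp (- ((s\<^sup>2 + r\<^sup>2) / 2)) * sinh (s * r * dot d u w)"
  proof -
    have "exp (- (dot d (?z q) (?z q) / 2)) = exp (- ((s\<^sup>2 + q\<^sup>2) / 2)) * exp (- (s * q * dot d u w))" for q
      unfolding norm by (simp add: add_divide_distrib flip: exp_add)
    from this[of r] this[of "- r"] show ?thesis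
      by (simp add: sinh_field_def right_diff_distrib)
  qed
  finally show ?thesis .
qed

text \<open>The characteristic function along multiples of \<open>u\<close> is that of a standard
  normal. This reduces integrability of \<open>\<bar>dot d g u\<bar>\<close> and its almost sure
  nonvanishing to one-dimensional facts.\<close>

lemma distr_dot:
  assumes "dot d u u = 1"
  shows "distr (std_gaussian d) borel (\<lambda>g. dot d g u) = std_normal_distribution"
proof (rule Levy_uniqueness[OF _ real_dist_normal_dist])
  interpret prob_space "std_gaussian d" by (rule prob_space_std_gaussian)
  show "real_distribution (distr (std_gaussian d) borel (\<lambda>g. dot d g u))"
    by (intro real_distribution_distr) auto
  have "char (distr (std_gaussian d) borel (\<lambda>g. dot d g u)) t = char std_normal_distribution t" for t
  proof -
    \<comment> \<open>The vanishing summand \<open>0 * u k\<close> only brings the multiple of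
      \<open>u\<close> into the shape of \<open>dot_lincomb\<close>.\<close>
    have "char (distr (std_gaussian d) borel (\<lambda>g. dot d g u)) t =
      (CLINT g|std_gaussian d. iexp (dot d g (\<lambda>k. t * u k + 0 * u k)))"
      unfolding char_def dot_lincomb by (subst integral_distr) auto
    also have "\<dots> = exp (- (t\<^sup>2 / 2))"
      unfolding integral_iexp_dot
      by (simp only: dot_lincomb dot_lincomb_left) (simp add: assms power2_eq_square)
    finally show ?thesis by (simp add: char_std_normal_distribution)
  qed
  then show "char (distr (std_gaussian d) borel (\<lambda>g. dot d g u)) = char std_normal_distribution"
    by blast
qed

lemma integrable_abs_dot:
  assumes "dot d u u = 1"
  shows "integrable (std_gaussian d) (\<lambda>g. \<bar>dot d g u\<bar>)"
  using integrable_std_normal_distribution_moment[of 1, folded distr_dot[OF assms]]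
  by (subst (asm) integrable_distr_eq) auto

lemma AE_dot_neq_0:
  assumes "dot d u u = 1"
  shows "AE g in std_gaussian d. dot d g u \<noteq> 0"
proof -
  have "AE x in std_normal_distribution. x \<noteq> 0"
    by (subst AE_density) (auto intro: AE_mp[OF AE_lborel_singleton[of 0]])
  then show ?thesis
    unfolding distr_dot[OF assms, symmetric] by (subst (asm) AE_distr_iff) auto
qed

section \<open>The truncated Dirichlet integral\<close>

text \<open>The Dirichlet integral converges only conditionally, so it is cut off at
  \<open>T\<close>. On the bounded interval, \<open>\<bar>sin x\<bar> \<le> \<bar>x\<bar>\<close>
  absorbs the factor \<open>1 / s\<close>, and Fubini applies. The cut-off replaces the sign of
  \<open>x\<close> by \<open>sgn x * Si (T * \<bar>x\<bar>)\<close>, which tends to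
  \<open>pi / 2\<close> times the sign as \<open>T\<close> grows.\<close>

lemma
  fixes T r :: real
  assumes u: "dot d u u = 1" and w: "dot d w w = 1" and "T \<ge> 0"
  defines "F \<equiv> \<lambda>s. indicator {0<..<T} s * (exp (- ((s\<^sup>2 + r\<^sup>2) / 2)) * sinh (s * r * dot d u w) / s)"
  shows integrable_Si_sin: "integrable lborel F"
    and integral_Si_sin: "prob_space.expectation (std_gaussian d)
      (\<lambda>g. sgn (dot d g u) * Si (T * \<bar>dot d g u\<bar>) * sin (r * dot d g w)) = (LBINT s. F s)"
proof -
  interpret prob_space "std_gaussian d" by (rule prob_space_std_gaussian)
  interpret pair_sigma_finite "std_gaussian d" "lborel :: real measure" ..
  let ?f = "\<lambda>g s. indicator {0<..<T} s * (sin (s * dot d g u) * sin (r * dot d g w) / s) :: real"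
  have bound: "\<bar>?f g s\<bar> \<le> \<bar>dot d g u\<bar> * indicator {0<..<T} s" for g s
  proof (cases "0 < s \<and> s < T")
    case True
    have "\<bar>sin (s * dot d g u) * sin (r * dot d g w)\<bar> \<le> \<bar>s * dot d g u\<bar> * 1"
      unfolding abs_mult[of "sin _"] by (intro mult_mono abs_sin_x_le_abs_x abs_sin_le_one) auto
    with True show ?thesis by (simp add: abs_mult field_simps)
  qed auto
  have int: "integrable (std_gaussian d \<Otimes>\<^sub>M lborel) (case_prod ?f)"
  proof (rule Bochner_Integration.integrable_bound)
    show "integrable (std_gaussian d \<Otimes>\<^sub>M lborel)
      (\<lambda>(g, s). \<bar>dot d g u\<bar> * (indicator {0<..<T} s :: real))"
    proof -
      have "integrable lborel (indicator {0<..<T} :: real \<Rightarrow> real)"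
        using \<open>T \<ge> 0\<close> by (intro integrable_real_indicator) auto
      then show ?thesis
        using integrable_abs_dot[OF u] by (intro Fubini_integrable) (auto simp: abs_mult)
    qed
    show "case_prod ?f \<in> borel_measurable (std_gaussian d \<Otimes>\<^sub>M lborel)"
      by measurable
    show "AE x in std_gaussian d \<Otimes>\<^sub>M lborel. norm (case_prod ?f x) \<le>
      norm (case x of (g, s) \<Rightarrow> \<bar>dot d g u\<bar> * (indicator {0<..<T} s :: real))"
      using bound by (auto simp: abs_mult)
  qed
  have F: "expectation (\<lambda>g. ?f g s) = F s" for s
    using integral_sin_sin_dot[OF u w, of s r] by (simp add: F_def)
  show "integrable lborel F"
    using integrable_snd[OF int] unfolding F .
  have "expectation (\<lambda>g. sgn (dot d g u) * Si (T * \<bar>dot d g u\<bar>) * sin (r * dot d g w)) =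
    expectation (\<lambda>g. LBINT s. ?f g s)"
  proof (intro Bochner_Integration.integral_cong refl)
    fix g
    have "sgn (dot d g u) * Si (T * \<bar>dot d g u\<bar>) = (LBINT s. indicator {0<..<T} s * (sin (s * dot d g u) / s))"
      unfolding LBINT_I0c_sin_scale_divide[OF \<open>T \<ge> 0\<close>, symmetric] using \<open>T \<ge> 0\<close>
      by (simp add: interval_lebesgue_integral_def zero_ereal_def set_lebesgue_integral_def)
    also have "\<dots> * sin (r * dot d g w) = (LBINT s. ?f g s)"
      by (subst integral_mult_left_zero[symmetric]) (simp add: mult.assoc)
    finally show "sgn (dot d g u) * Si (T * \<bar>dot d g u\<bar>) * sin (r * dot d g w) = (LBINT s. ?f g s)" .
  qed
  also have "\<dots> = (LBINT s. F s)"
    unfolding Fubini_integral[OF int, symmetric] F ..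
  finally show "expectation (\<lambda>g. sgn (dot d g u) * Si (T * \<bar>dot d g u\<bar>) * sin (r * dot d g w)) = (LBINT s. F s)" .
qed

section \<open>Counting lattice points and finding a cluster\<close>

text \<open>Only the bound 3, uniform in \<open>N\<close>, is wanted later; the exact value is what
  makes the induction close.\<close>

lemma sum_half_power_abs:
  "(\<Sum>z\<in>{- int N..int N}. (1 / 2) ^ nat \<bar>z\<bar>) = (3 - 2 * (1 / 2) ^ N :: real)"
proof (induction N)
  case (Suc N)
  have *: "{- int (Suc N)..int (Suc N)} =
    insert (int (Suc N)) (insert (- int (Suc N)) {- int N..int N})" by auto
  have "(\<Sum>z\<in>{- int (Suc N)..int (Suc N)}. (1 / 2) ^ nat \<bar>z\<bar>) =
    (1 / 2) ^ Suc N + ((1 / 2) ^ Suc N + (\<Sum>z\<in>{- int N..int N}. (1 / 2) ^ nat \<bar>z\<bar>) :: real)"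
    unfolding * by (simp add: nat_add_distrib)
  then show ?case unfolding Suc by simp
qed simp

text \<open>Each lattice point of the ball has weight \<open>2\<^sup>N * 2 powr (- \<parallel>z\<parallel>\<^sub>1) \<ge> 1\<close>, and the weights factorise.\<close>

lemma card_int_l1_ball_le:
  fixes d N :: nat
  defines "B \<equiv> {z \<in> {..<d} \<rightarrow>\<^sub>E {- int N..int N}. (\<Sum>k<d. nat \<bar>z k\<bar>) \<le> N}"
  shows "real (card B) \<le> 2 ^ N * 3 ^ d"
proof -
  let ?P = "{..<d} \<rightarrow>\<^sub>E {- int N..int N}"
  have fin: "finite ?P" by (simp add: finite_PiE)
  have "real (card B) = (\<Sum>z\<in>B. 1)" by simp
  also have "\<dots> \<le> (\<Sum>z\<in>B. 2 ^ N * (\<Prod>k<d. (1 / 2) ^ nat \<bar>z k\<bar>))"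
  proof (rule sum_mono)
    fix z assume "z \<in> B"
    then have "(2 :: real) ^ (\<Sum>k<d. nat \<bar>z k\<bar>) \<le> 2 ^ N"
      by (intro power_increasing) (auto simp: B_def)
    moreover have "(\<Prod>k<d. (1 / 2 :: real) ^ nat \<bar>z k\<bar>) = 1 / 2 ^ (\<Sum>k<d. nat \<bar>z k\<bar>)"
      by (simp only: power_one_over power_sum prod_dividef prod.neutral_const)
    ultimately show "1 \<le> 2 ^ N * (\<Prod>k<d. (1 / 2 :: real) ^ nat \<bar>z k\<bar>)"
      by simp
  qed
  also have "\<dots> \<le> (\<Sum>z\<in>?P. 2 ^ N * (\<Prod>k<d. (1 / 2) ^ nat \<bar>z k\<bar>))"
  proof (rule sum_mono2[OF fin])
    show "B \<subseteq> ?P" unfolding B_def by (rule Collect_restrict)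
    show "0 \<le> 2 ^ N * (\<Prod>k<d. (1 / 2 :: real) ^ nat \<bar>z k\<bar>)" for z
      by (intro mult_nonneg_nonneg prod_nonneg) simp_all
  qed
  also have "\<dots> = 2 ^ N * (\<Prod>k<d. \<Sum>z\<in>{- int N..int N}. (1 / 2) ^ nat \<bar>z\<bar>)"
    using infsetsum_prod_PiE[of "{..<d}" "\<lambda>_. {- int N..int N}" "\<lambda>_ z. (1 / 2 :: real) ^ nat \<bar>z\<bar>"] fin
    by (simp flip: sum_distrib_left)
  also have "\<dots> \<le> 2 ^ N * (\<Prod>k<d. 3)"
    using power_le_one[of "1 / 2 :: real" N] unfolding sum_half_power_abs
    by (intro mult_left_mono prod_mono) simp_all
  finally show ?thesis by simp
qed

lemma L2_set_eq_1_iff_dot: "(L2_set v {..<d} = 1) \<longleftrightarrow> dot d v v = 1"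
  by (simp add: L2_set_def dot_def power2_eq_square)

text \<open>Rounding \<open>4 * sqrt d * v i\<close> coordinatewise sends every unit vector to an
  integer point of l1-norm at most \<open>5 * d\<close>. There are at most
  \<open>(2 ^ 5 * 3) ^ d = 96 ^ d\<close> such points, so some point is hit by a large share of the
  vectors, and any vector \<open>v j\<close> rounded to it serves as the centre.\<close>

lemma exists_cluster:
  fixes v :: "nat \<Rightarrow> nat \<Rightarrow> real"
  assumes "d \<ge> 1" "n \<ge> 1" and unit: "\<And>i. i < n \<Longrightarrow> dot d (v i) (v i) = 1"
  shows "\<exists>j<n. real n \<le> real (card {i. i < n \<and> dot d (v i) (v j) \<ge> 0.95}) * 128 ^ d"
proof -
  define c where "c i = (\<lambda>k\<in>{..<d}. \<lfloor>4 * sqrt d * v i k\<rfloor>)" for i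
  define B where "B = {z \<in> {..<d} \<rightarrow>\<^sub>E {- int (5 * d)..int (5 * d)}. (\<Sum>k<d. nat \<bar>z k\<bar>) \<le> 5 * d}"
  have finB: "finite B" 
    unfolding B_def
    by (rule finite_subset[of _ "{..<d} \<rightarrow>\<^sub>E {- int (5 * d)..int (5 * d)}"]) (auto intro!: finite_PiE)
  have c_B: "c i \<in> B" if "i < n" for i
  proof -
    \<comment> \<open>Cauchy-Schwarz against the all-ones vector. Scaling by
      \<open>4 * sqrt d\<close> gives \<open>4 * d\<close>, and rounding costs at most 1 per
      coordinate, hence the radius \<open>5 * d\<close>.\<close>
    have sum_abs: "(\<Sum>k<d. \<bar>v i k\<bar>) \<le> sqrt d"
    proof (rule real_le_rsqrt)
      have "(\<Sum>k<d. \<bar>v i k\<bar> * 1)\<^sup>2 \<le> (\<Sum>k<d. \<bar>v i k\<bar>\<^sup>2) * (\<Sum>k<d. 1\<^sup>2)"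
        by (rule Cauchy_Schwarz_ineq_sum)
      then show "(\<Sum>k<d. \<bar>v i k\<bar>)\<^sup>2 \<le> d"
        using unit[OF that] by (simp add: dot_def power2_eq_square)
    qed
    have "real (\<Sum>k<d. nat \<bar>c i k\<bar>) \<le> (\<Sum>k<d. 4 * sqrt d * \<bar>v i k\<bar> + 1)"
      unfolding of_nat_sum
    proof (rule sum_mono)
      fix k assume "k \<in> {..<d}"
      then have "real (nat \<bar>c i k\<bar>) = \<bar>real_of_int \<lfloor>4 * sqrt d * v i k\<rfloor>\<bar>"
        by (simp add: c_def)
      also have "\<dots> \<le> \<bar>4 * sqrt d * v i k\<bar> + 1" by linarith
      also have "\<dots> = 4 * sqrt d * \<bar>v i k\<bar> + 1" by (simp add: abs_mult)
      finally show "real (nat \<bar>c i k\<bar>) \<le> 4 * sqrt d * \<bar>v i k\<bar> + 1" .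
    qed
    also have "\<dots> = 4 * sqrt d * (\<Sum>k<d. \<bar>v i k\<bar>) + d"
      by (simp add: sum.distrib sum_distrib_left)
    also have "\<dots> \<le> 4 * sqrt d * sqrt d + d"
      using sum_abs by (intro add_mono mult_left_mono) auto
    also have "\<dots> = real (5 * d)" by simp
    finally have "real (\<Sum>k<d. nat \<bar>c i k\<bar>) \<le> real (5 * d)" .
    then have le: "(\<Sum>k<d. nat \<bar>c i k\<bar>) \<le> 5 * d" by (simp only: of_nat_le_iff)
    have "c i k \<in> {- int (5 * d)..int (5 * d)}" if "k < d" for k
    proof -
      have "nat \<bar>c i k\<bar> \<le> (\<Sum>k<d. nat \<bar>c i k\<bar>)" using that by (intro member_le_sum) auto
      with le show ?thesis by auto
    qed
    with le show ?thesis by (auto simp: B_def c_def)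
  qed
  have "\<exists>y\<in>B. card (c -` {y} \<inter> {..<n}) * card B \<ge> card {..<n}"
    using c_B finB \<open>n \<ge> 1\<close> by (intro pigeonhole_card) auto
  then obtain y where y: "n \<le> card (c -` {y} \<inter> {..<n}) * card B" by auto
  with \<open>n \<ge> 1\<close> have "c -` {y} \<inter> {..<n} \<noteq> {}" by (metis card.empty mult_0 not_one_le_zero le_trans)
  then obtain j where j: "j < n" "c j = y" by auto
  \<comment> \<open>Equal floors keep each coordinate difference within
    \<open>1 / (4 * sqrt d)\<close>, so the squared distance is at most 1/16. For unit vectors the
    inner product is then at least 31/32.\<close>
  have close: "dot d (v i) (v j) \<ge> 0.95" if "i < n" "c i = c j" for i
  proof -
    have "(\<Sum>k<d. (v i k - v j k)\<^sup>2) \<le> (\<Sum>k<d. 1 / (16 * d))"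
    proof (rule sum_mono)
      fix k assume "k \<in> {..<d}"
      then have "\<lfloor>4 * sqrt d * v i k\<rfloor> = \<lfloor>4 * sqrt d * v j k\<rfloor>"
        using fun_cong[OF that(2), of k] by (simp add: c_def)
      then have "\<bar>4 * sqrt d * v i k - 4 * sqrt d * v j k\<bar> \<le> 1" by linarith
      then have "(4 * sqrt d * v i k - 4 * sqrt d * v j k)\<^sup>2 \<le> 1"
        by (simp add: abs_square_le_1)
      also have "(4 * sqrt d * v i k - 4 * sqrt d * v j k)\<^sup>2 = 16 * d * (v i k - v j k)\<^sup>2"
        by (simp add: power_mult_distrib flip: right_diff_distrib)
      finally show "(v i k - v j k)\<^sup>2 \<le> 1 / (16 * d)"
        using \<open>d \<ge> 1\<close> by (simp add: field_simps)
    qed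
    also have "\<dots> = 1 / 16" using \<open>d \<ge> 1\<close> by simp
    finally have "(\<Sum>k<d. (v i k - v j k)\<^sup>2) \<le> 1 / 16" .
    moreover have "(\<Sum>k<d. (v i k - v j k)\<^sup>2) = dot d (v i) (v i) + dot d (v j) (v j) - 2 * dot d (v i) (v j)"
      by (simp add: dot_def sum.distrib sum_subtractf sum_distrib_left power2_eq_square algebra_simps)
    ultimately show ?thesis using unit[OF \<open>i < n\<close>] unit[OF \<open>j < n\<close>] by simp
  qed
  have "real (card B) \<le> 2 ^ (5 * d) * 3 ^ d" unfolding B_def by (rule card_int_l1_ball_le)
  also have "\<dots> = 96 ^ d" by (simp add: power_mult flip: power_mult_distrib)
  also have "\<dots> \<le> 128 ^ d" by (intro power_mono) auto
  finally have "real (card B) \<le> 128 ^ d" .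
  moreover have "card (c -` {y} \<inter> {..<n}) \<le> card {i. i < n \<and> dot d (v i) (v j) \<ge> 0.95}"
    using close j by (intro card_mono) auto
  ultimately have "real (card (c -` {y} \<inter> {..<n})) * real (card B) \<le>
    real (card {i. i < n \<and> dot d (v i) (v j) \<ge> 0.95}) * 128 ^ d"
    by (intro mult_mono) auto
  moreover have "real n \<le> real (card (c -` {y} \<inter> {..<n})) * real (card B)"
    using y by (simp flip: of_nat_mult)
  ultimately show ?thesis using j(1) by (intro exI[of _ j] conjI) linarith+
qed

section \<open>Estimates for sums of hyperbolic sines\<close>

text \<open>The factor \<open>y\<close> is kept because it later cancels the singularity
  \<open>1 / s\<close> at the origin.\<close>

lemma sinh_le_mult_exp:
  fixes y :: real
  assumes "y \<ge> 0"
  shows "sinh y \<le> y * exp y"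
proof -
  have "1 - exp (- (2 * y)) \<le> 2 * y" using exp_ge_add_one_self[of "- (2 * y)"] by linarith
  then have "exp y * (1 - exp (- (2 * y))) \<le> exp y * (2 * y)" by (intro mult_left_mono) auto
  moreover have "exp y * (1 - exp (- (2 * y))) = 2 * sinh y"
    by (simp add: sinh_field_def right_diff_distrib flip: exp_add)
  ultimately have "2 * sinh y \<le> exp y * (2 * y)" by (simp only:)
  then show ?thesis by (simp add: mult.commute)
qed

text \<open>This is the amplification of a gap \<open>b - a\<close> in the arguments: the left side
  is \<open>(exp b - exp (b - 2 * a)) / 2\<close>, and the subtracted term is at least
  \<open>exp (- b)\<close>.\<close>

lemma exp_mult_sinh_le:
  fixes a b :: real
  assumes "a \<le> b"
  shows "exp (b - a) * sinh a \<le> sinh b"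
proof -
  have "exp (- b) \<le> exp (b - 2 * a)" using assms by simp
  then show ?thesis by (simp add: sinh_field_def right_diff_distrib flip: exp_add)
qed

lemma sinh_ge_exp:
  fixes y :: real
  assumes "y \<ge> 1"
  shows "exp y / 4 \<le> sinh y"
proof -
  have "2 \<le> exp (2 * y)" using exp_ge_add_one_self[of "2 * y"] assms by linarith
  then have "exp (- y) * 2 \<le> exp (- y) * exp (2 * y)" by (intro mult_left_mono) auto
  also have "\<dots> = exp y" by (simp flip: exp_add)
  finally show ?thesis by (simp add: sinh_field_def)
qed

text \<open>By monotonicity a cluster term is at least \<open>sinh (0.95 * x)\<close> and any other
  at least \<open>- sinh (0.9 * x)\<close>. Charging the loss to the cluster terms too makes its
  total simply \<open>n\<close> copies.\<close>

lemma sum_sinh_ge: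
  fixes t :: "nat \<Rightarrow> real"
  assumes "x \<ge> 0" and t: "\<And>i. i < n \<Longrightarrow> t i \<ge> - 0.9"
  shows "(\<Sum>i<n. sinh (x * t i)) \<ge>
    real (card {i. i < n \<and> t i \<ge> 0.95}) * sinh (0.95 * x) - real n * sinh (0.9 * x)"
proof -
  have "real (card {i. i < n \<and> t i \<ge> 0.95}) * sinh (0.95 * x) - real n * sinh (0.9 * x) =
    (\<Sum>i<n. (if t i \<ge> 0.95 then sinh (0.95 * x) else 0) - sinh (0.9 * x))"
    by (simp add: sum_subtractf sum.If_cases Collect_conj_eq lessThan_def)
  also have "\<dots> \<le> (\<Sum>i<n. sinh (x * t i))"
  proof (rule sum_mono)
    fix i assume "i \<in> {..<n}"
    show "(if t i \<ge> 0.95 then sinh (0.95 * x) else 0) - sinh (0.9 * x) \<le> sinh (x * t i)"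
    proof (cases "t i \<ge> 0.95")
      case True
      then have "sinh (0.95 * x) \<le> sinh (x * t i)"
        using \<open>x \<ge> 0\<close> mult_left_mono[of "0.95" "t i" x] by (simp add: mult.commute)
      moreover have "0 \<le> sinh (0.9 * x)" using \<open>x \<ge> 0\<close> by simp
      ultimately have "sinh (0.95 * x) - sinh (0.9 * x) \<le> sinh (x * t i)" by linarith
      with True show ?thesis by (simp only: if_True)
    next
      case False
      have "x * (- 0.9) \<le> x * t i" using t \<open>i \<in> {..<n}\<close> \<open>x \<ge> 0\<close> by (intro mult_left_mono) auto
      then have "sinh (- (0.9 * x)) \<le> sinh (x * t i)"
        unfolding sinh_real_le_iff by (simp add: mult.commute)
      with False show ?thesis by simp
    qed
  qed
  finally show ?thesis .
qed

text \<open>The threshold gives \<open>0.05 * x \<ge> 8 * d\<close>, and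
  \<open>exp (8 * d) \<ge> 2 ^ (8 * d) \<ge> 2 * 128 ^ d\<close>. The cluster therefore gains twice
  the total possible loss, and one copy is left over.\<close>

lemma sum_sinh_ge_sinh:
  fixes t :: "nat \<Rightarrow> real"
  assumes "d \<ge> 1" "x \<ge> 160 * real d" and t: "\<And>i. i < n \<Longrightarrow> t i \<ge> - 0.9"
    and m: "real n \<le> real (card {i. i < n \<and> t i \<ge> 0.95}) * 128 ^ d"
  shows "(\<Sum>i<n. sinh (x * t i)) \<ge> real n * sinh (0.9 * x)"
proof -
  let ?m = "real (card {i. i < n \<and> t i \<ge> 0.95})"
  have x: "x \<ge> 0" using assms(2) by (rule order_trans[rotated]) simp
  have "(2 :: real) * 128 ^ d \<le> 2 ^ d * 128 ^ d"
    using power_increasing[of 1 d "2 :: real"] \<open>d \<ge> 1\<close> by (intro mult_right_mono) auto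
  also have "\<dots> = (2 ^ 8) ^ d" by (simp flip: power_mult_distrib)
  also have "\<dots> \<le> (exp 1 ^ 8) ^ d"
    using exp_ge_add_one_self[of 1] by (intro power_mono) auto
  also have "\<dots> = exp (8 * real d)" by (simp flip: exp_of_nat_mult)
  also have "\<dots> \<le> exp (0.95 * x - 0.9 * x)" using assms(2) by simp
  finally have "2 * 128 ^ d * sinh (0.9 * x) \<le> exp (0.95 * x - 0.9 * x) * sinh (0.9 * x)"
    using x by (intro mult_right_mono) auto
  also have "\<dots> \<le> sinh (0.95 * x)" using x by (intro exp_mult_sinh_le) auto
  finally have "?m * (2 * 128 ^ d * sinh (0.9 * x)) \<le> ?m * sinh (0.95 * x)"
    by (rule mult_left_mono) simp
  moreover have "real n * (2 * sinh (0.9 * x)) \<le> ?m * 128 ^ d * (2 * sinh (0.9 * x))"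
    using m x by (intro mult_right_mono) auto
  ultimately show ?thesis using sum_sinh_ge[of x n t, OF x t] by (simp add: mult_ac)
qed

text \<open>
  The sum can be negative only for \<open>s * r \<le> 160 d\<close>; with \<open>r\<^sup>2 = 4000 d\<close> this loss is outweighed
  by the interval from \<open>r\<close> to \<open>3 / 2 * r\<close> alone.
\<close>

lemma sum_gauss_sinh_ge:
  fixes t :: "nat \<Rightarrow> real" and r s :: real
  assumes "d \<ge> 1" and r: "r = sqrt (4000 * real d)" and "s > 0"
    and t: "\<And>i. i < n \<Longrightarrow> t i \<ge> - 0.9"
    and m: "real n \<le> real (card {i. i < n \<and> t i \<ge> 0.95}) * 128 ^ d"
  shows "(\<Sum>i<n. exp (- (s\<^sup>2 / 2)) * sinh (s * r * t i) / s) \<ge>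
    real n * exp (600 * real d) / (6 * r) * indicator {r..3 / 2 * r} s
    - real n * r * exp (144 * real d) * indicator {0<..160 * real d / r} s" (is "?L \<ge> ?R")
proof -
  have r0: "r > 0" and rr: "r * r = 4000 * real d" using \<open>d \<ge> 1\<close> by (auto simp: r)
  have L: "?L = exp (- (s\<^sup>2 / 2)) / s * (\<Sum>i<n. sinh (s * r * t i))"
    by (simp add: sum_distrib_left)
  consider "s \<le> 160 * real d / r" | "s > 160 * real d / r" "s \<notin> {r..3 / 2 * r}" | "s \<in> {r..3 / 2 * r}"
    by fastforce
  then show ?thesis
  proof cases
    case 1
    then have sr: "s * r \<le> 160 * real d" using r0 by (simp add: field_simps)
    \<comment> \<open>Since \<open>r * r = 4000 * d\<close>, the two intervals in \<open>?R\<close>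
      are disjoint and only the loss term is present here.\<close>
    have "160 * real d / r < r" using r0 rr \<open>d \<ge> 1\<close> by (simp add: field_simps)
    with 1 have R: "?R = - (real n * r * exp (144 * real d))" using \<open>s > 0\<close> by simp
    \<comment> \<open>The factor \<open>s\<close> produced here cancels \<open>1 / s\<close>, so the
      loss stays bounded near 0. The exponent is \<open>0.9 * 160 = 144\<close>.\<close>
    have "sinh (0.9 * (s * r)) \<le> 0.9 * (s * r) * exp (0.9 * (s * r))"
      using \<open>s > 0\<close> r0 by (intro sinh_le_mult_exp) auto
    also have "\<dots> \<le> (s * r) * exp (144 * real d)"
      using \<open>s > 0\<close> r0 sr by (intro mult_mono[of "0.9 * (s * r)" "s * r"]) (auto simp: mult.commute)
    finally have "real n * sinh (0.9 * (s * r)) \<le> real n * (s * r * exp (144 * real d))"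
      by (intro mult_left_mono) auto
    moreover have "(\<Sum>i<n. sinh (s * r * t i)) \<ge> - (real n * sinh (0.9 * (s * r)))"
    proof -
      have "0 \<le> real (card {i. i < n \<and> t i \<ge> 0.95}) * sinh (0.95 * (s * r))"
        using \<open>s > 0\<close> r0 by simp
      moreover have "s * r \<ge> 0" using \<open>s > 0\<close> r0 by simp
      note sum_sinh_ge[of "s * r" n t, OF this t]
      ultimately show ?thesis by linarith
    qed
    ultimately have "(\<Sum>i<n. sinh (s * r * t i)) \<ge> - (real n * (s * r * exp (144 * real d)))" by linarith
    then have "?L \<ge> exp (- (s\<^sup>2 / 2)) / s * (- (real n * (s * r * exp (144 * real d))))"
      unfolding L using \<open>s > 0\<close> by (intro mult_left_mono) auto
    moreover have "exp (- (s\<^sup>2 / 2)) / s * (- (real n * (s * r * exp (144 * real d)))) =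
      - (exp (- (s\<^sup>2 / 2)) * (real n * r * exp (144 * real d)))"
      using \<open>s > 0\<close> by simp
    moreover have "exp (- (s\<^sup>2 / 2)) * (real n * r * exp (144 * real d)) \<le> 1 * (real n * r * exp (144 * real d))"
      using r0 by (intro mult_right_mono) auto
    ultimately show ?thesis unfolding R by linarith
  next
    case 2
    then have "s * r \<ge> 160 * real d" using r0 by (simp add: field_simps)
    then have "(\<Sum>i<n. sinh (s * r * t i)) \<ge> real n * sinh (0.9 * (s * r))"
      using \<open>d \<ge> 1\<close> t m by (intro sum_sinh_ge_sinh) auto
    moreover have "real n * sinh (0.9 * (s * r)) \<ge> 0" using \<open>s > 0\<close> r0 by simp
    ultimately have "(\<Sum>i<n. sinh (s * r * t i)) \<ge> 0" by linarith
    then have "?L \<ge> 0" unfolding L using \<open>s > 0\<close> by simp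
    with 2 show ?thesis by simp
  next
    case 3
    have "160 * real d / r < r" using r0 rr \<open>d \<ge> 1\<close> by (simp add: field_simps)
    with 3 have R: "?R = real n * exp (600 * real d) / (6 * r)" by simp
    have sr: "s * r \<ge> 4000 * real d" using 3 r0 unfolding rr[symmetric] by simp
    then have "(\<Sum>i<n. sinh (s * r * t i)) \<ge> real n * sinh (0.9 * (s * r))"
      using \<open>d \<ge> 1\<close> t m by (intro sum_sinh_ge_sinh) auto
    moreover have "sinh (0.9 * (s * r)) \<ge> exp (0.9 * (s * r)) / 4"
      using sr \<open>d \<ge> 1\<close> by (intro sinh_ge_exp) auto
    then have "real n * sinh (0.9 * (s * r)) \<ge> real n * (exp (0.9 * (s * r)) / 4)"
      by (intro mult_left_mono) auto
    ultimately have "(\<Sum>i<n. sinh (s * r * t i)) \<ge> real n * (exp (0.9 * (s * r)) / 4)" by linarith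
    then have "?L \<ge> exp (- (s\<^sup>2 / 2)) / s * (real n * (exp (0.9 * (s * r)) / 4))"
      unfolding L using \<open>s > 0\<close> by (intro mult_left_mono) auto
    also have "exp (0.9 * (s * r)) = exp (0.9 * (s * r) - s\<^sup>2 / 2) / exp (- (s\<^sup>2 / 2))"
      by (simp flip: exp_diff)
    also have "exp (- (s\<^sup>2 / 2)) / s * (real n * (exp (0.9 * (s * r) - s\<^sup>2 / 2) / exp (- (s\<^sup>2 / 2)) / 4)) =
      real n * exp (0.9 * (s * r) - s\<^sup>2 / 2) / (4 * s)"
      by simp
    finally have L': "?L \<ge> real n * exp (0.9 * (s * r) - s\<^sup>2 / 2) / (4 * s)" .
    \<comment> \<open>From \<open>s \<le> 3 / 2 * r\<close> one has
      \<open>s\<^sup>2 / 2 \<le> 0.75 * (s * r)\<close>, so the exponent is at least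
      \<open>0.15 * (s * r)\<close>. With \<open>s \<ge> r\<close> this is at least
      \<open>0.15 * 4000 * d = 600 * d\<close>.\<close>
    have "0.15 * (r * r) \<le> 0.15 * (s * r)" using 3 r0 by simp
    also have "\<dots> \<le> 0.9 * (s * r) - s\<^sup>2 / 2"
      using 3 mult_left_mono[of s "3 / 2 * r" s] \<open>s > 0\<close> by (simp add: power2_eq_square)
    finally have "exp (600 * real d) \<le> exp (0.9 * (s * r) - s\<^sup>2 / 2)" unfolding rr by simp
    then have "real n * exp (600 * real d) / (6 * r) \<le> real n * exp (0.9 * (s * r) - s\<^sup>2 / 2) / (4 * s)"
      using 3 \<open>s > 0\<close> by (intro frac_le mult_left_mono) auto
    with L' show ?thesis unfolding R by linarith
  qed
qed

section \<open>Integrating the bound and testing against the sine\<close>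

text \<open>The two terms are the gain and the loss of \<open>sum_gauss_sinh_ge\<close> integrated
  over their intervals and divided by \<open>n\<close>.\<close>

lemma exp_600_minus_exp_144_ge_1:
  assumes "d \<ge> 1"
  shows "exp (600 * real d) / 12 - 160 * real d * exp (144 * real d) \<ge> 1"
proof -
  have "160 * real d * exp (144 * real d) \<le> exp (160 * real d) * exp (144 * real d)"
    using exp_ge_add_one_self[of "160 * real d"] by (intro mult_right_mono exp_ge_zero) linarith
  also have "\<dots> = exp (304 * real d)" by (simp flip: exp_add)
  finally have "160 * real d * exp (144 * real d) \<le> exp (304 * real d)" .
  moreover have "24 \<le> exp (296 * real d)"
    using exp_ge_add_one_self[of "296 * real d"] assms by linarith
  then have "24 * exp (304 * real d) \<le> exp (296 * real d) * exp (304 * real d)"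
    by (intro mult_right_mono) auto
  then have "24 * exp (304 * real d) \<le> exp (600 * real d)" by (simp flip: exp_add)
  moreover have "1 \<le> exp (304 * real d)" by simp
  ultimately show ?thesis by linarith
qed

lemma expectation_square_le:
  assumes "prob_space M" and [measurable]: "Z \<in> borel_measurable M" and "\<And>x. \<bar>Z x\<bar> \<le> (B :: real)"
  shows "(prob_space.expectation M Z)\<^sup>2 \<le> prob_space.expectation M (\<lambda>x. (Z x)\<^sup>2)"
proof -
  interpret prob_space M by fact
  have "integrable M Z" by (rule integrable_const_bound[where B=B]) (auto simp: assms(3))
  moreover have "integrable M (\<lambda>x. (Z x)\<^sup>2)"
    using order_trans[OF assms(3) abs_ge_self]
    by (intro integrable_const_bound[where B="B\<^sup>2"]) (auto simp flip: abs_le_square_iff)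
  ultimately show ?thesis using variance_eq[of Z] variance_positive[of Z] by linarith
qed

lemma pm_sgn_eq_sgn: "t \<noteq> 0 \<Longrightarrow> pm_sgn t = sgn t"
  by (simp add: pm_sgn_def)

text \<open>The pointwise bound \<open>sum_gauss_sinh_ge\<close> is integrated over
  \<open>s\<close>; the factor \<open>exp (- (2000 * real d))\<close> is
  \<open>exp (- (r\<^sup>2 / 2))\<close>. The resulting bound is independent of \<open>T\<close>, so
  it survives the limit.\<close>

lemma integral_Si_sin_ge:
  fixes v :: "nat \<Rightarrow> nat \<Rightarrow> real" and r T :: real
  assumes d: "d \<ge> 1" and j: "j < n" and r: "r = sqrt (4000 * real d)" and T: "T > 3 / 2 * r"
    and unit: "\<And>i. i < n \<Longrightarrow> dot d (v i) (v i) = 1"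
    and t: "\<And>i. i < n \<Longrightarrow> dot d (v i) (v j) \<ge> - 0.9"
    and m: "real n \<le> real (card {i. i < n \<and> dot d (v i) (v j) \<ge> 0.95}) * 128 ^ d"
  shows "prob_space.expectation (std_gaussian d)
      (\<lambda>g. (\<Sum>i<n. sgn (dot d g (v i)) * Si (T * \<bar>dot d g (v i)\<bar>)) * sin (r * dot d g (v j)))
    \<ge> real n * exp (- (2000 * real d))"
proof -
  interpret prob_space "std_gaussian d" by (rule prob_space_std_gaussian)
  have r0: "r > 0" and r2: "r\<^sup>2 = 4000 * d" using d by (auto simp: r)
  have "160 * d / r < r" using r0 r2 d by (simp add: field_simps power2_eq_square)
  with T r0 have T0: "T \<ge> 0" "T > 160 * d / r" by linarith+
  define F where "F i s = indicator {0<..<T} s * (exp (- ((s\<^sup>2 + r\<^sup>2) / 2)) * sinh (s * r * dot d (v i) (v j)) / s)" for i s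
  define a where "a = real n * exp (600 * real d) / (6 * r)"
  define b where "b = real n * r * exp (144 * real d)"
  define G where "G s = exp (- (2000 * real d)) *
    (a * indicator {r..3 / 2 * r} s - b * indicator {0<..160 * real d / r} s)" for s
  have intF: "integrable lborel (F i)" if "i < n" for i
    unfolding F_def by (rule integrable_Si_sin[OF unit[OF that] unit[OF j] T0(1)])
  have intG: "integrable lborel G"
    unfolding G_def using r0
    by (intro integrable_mult_right Bochner_Integration.integrable_diff integrable_real_indicator) auto
  have "exp (- (2000 * real d)) * (real n * 1) \<le> exp (- (2000 * real d)) *
      (real n * (exp (600 * real d) / 12 - 160 * real d * exp (144 * real d)))"
    using exp_600_minus_exp_144_ge_1[OF d] by (intro mult_left_mono) auto
  \<comment> \<open>The intervals have lengths \<open>r / 2\<close> and \<open>160 * d / r\<close>,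
    which cancel the powers of \<open>r\<close> in \<open>a\<close> and \<open>b\<close>.\<close>
  also have "\<dots> = exp (- (2000 * real d)) * (a * (r / 2) - b * (160 * real d / r))"
    using r0 by (simp add: a_def b_def field_simps)
  also have "\<dots> = (LBINT s. G s)"
    unfolding G_def using r0 by (subst integral_mult_right_zero, subst Bochner_Integration.integral_diff)
      (auto simp: field_simps intro!: integrable_real_indicator integrable_mult_right)
  also have "\<dots> \<le> (LBINT s. \<Sum>i<n. F i s)"
  proof (rule integral_mono)
    fix s
    show "G s \<le> (\<Sum>i<n. F i s)"
    proof (cases "0 < s \<and> s < T")
      case True
      have "(\<Sum>i<n. F i s) = exp (- (2000 * real d)) *
        (\<Sum>i<n. exp (- (s\<^sup>2 / 2)) * sinh (s * r * dot d (v i) (v j)) / s)"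
      proof -
        have "exp (- ((s\<^sup>2 + r\<^sup>2) / 2)) = exp (- (2000 * real d)) * exp (- (s\<^sup>2 / 2))"
          by (simp add: r2 add_divide_distrib flip: exp_add)
        then show ?thesis using True by (simp add: F_def sum_distrib_left mult.assoc)
      qed
      also have "\<dots> \<ge> G s"
        unfolding G_def a_def b_def using sum_gauss_sinh_ge[OF d r _ t m, of s] True
        by (intro mult_left_mono) auto
      finally show ?thesis .
    next
      case False
      \<comment> \<open>Both intervals of \<open>G\<close> lie inside \<open>{0<..<T}\<close>, so
        both sides vanish here.\<close>
      then show ?thesis using r0 T T0 by (auto simp: F_def G_def)
    qed
  qed (use intF intG in auto)
  also have "\<dots> = (\<Sum>i<n. LBINT s. F i s)"
    using intF by simp
  also have "\<dots> = (\<Sum>i<n. expectation (\<lambda>g. sgn (dot d g (v i)) * Si (T * \<bar>dot d g (v i)\<bar>) * sin (r * dot d g (v j))))"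
    using integral_Si_sin[OF unit unit[OF j] T0(1)] by (simp add: F_def[abs_def])
  also have "\<dots> = expectation (\<lambda>g. (\<Sum>i<n. sgn (dot d g (v i)) * Si (T * \<bar>dot d g (v i)\<bar>)) * sin (r * dot d g (v j)))"
  proof -
    obtain B where B: "\<bar>Si t\<bar> \<le> B" for t using bounded_Si by blast
    have "\<bar>sgn x * Si y * sin z\<bar> \<le> B" for x y z :: real
    proof -
      have "\<bar>sgn x * Si y * sin z\<bar> \<le> 1 * B * 1"
        unfolding abs_mult using B[of y] by (intro mult_mono) (auto simp: sgn_if)
      then show ?thesis by simp
    qed
    then have "integrable (std_gaussian d) (\<lambda>g. sgn (dot d g (v i)) * Si (T * \<bar>dot d g (v i)\<bar>) * sin (r * dot d g (v j)))" for i
      by (intro integrable_const_bound[where B=B]) auto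
    then show ?thesis by (simp add: sum_distrib_right)
  qed
  finally show ?thesis by (simp add: mult.commute)
qed

theorem theorem2:
  shows "\<exists>c::real. c > 0 \<and>
    (\<forall>(d::nat) (n::nat) (v :: nat \<Rightarrow> nat \<Rightarrow> real).
      d \<ge> 1 \<longrightarrow> n \<ge> 1 \<longrightarrow>
      (\<forall>i<n. L2_set (v i) {..<d} = 1) \<longrightarrow>
      (\<forall>i<n. \<forall>j<n. i \<noteq> j \<longrightarrow> dot d (v i) (v j) \<ge> - 0.9) \<longrightarrow>
      prob_space.expectation (std_gaussian d) (\<lambda>g. (\<Sum>i<n. pm_sgn (dot d g (v i)))\<^sup>2)
        \<ge> (real n)\<^sup>2 * 2 powr (- (c * real d)))"
proof (intro exI[of _ 8004] conjI allI impI)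
  fix d n :: nat and v :: "nat \<Rightarrow> nat \<Rightarrow> real"
  assume d: "d \<ge> 1" and n: "n \<ge> 1" and "\<forall>i<n. L2_set (v i) {..<d} = 1"
    and sep: "\<forall>i<n. \<forall>j<n. i \<noteq> j \<longrightarrow> dot d (v i) (v j) \<ge> - 0.9"
  then have unit: "dot d (v i) (v i) = 1" if "i < n" for i
    using that by (simp add: L2_set_eq_1_iff_dot)
  interpret prob_space "std_gaussian d" by (rule prob_space_std_gaussian)
  have "\<exists>j<n. real n \<le> real (card {i. i < n \<and> dot d (v i) (v j) \<ge> 0.95}) * 128 ^ d"
    using d n unit by (rule exists_cluster)
  then obtain j where j: "j < n"
    and m: "real n \<le> real (card {i. i < n \<and> dot d (v i) (v j) \<ge> 0.95}) * 128 ^ d"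
    by blast
  \<comment> \<open>The separation hypothesis covers \<open>i \<noteq> j\<close>; for
    \<open>i = j\<close> the inner product is 1.\<close>
  have t: "dot d (v i) (v j) \<ge> - 0.9" if "i < n" for i
    using sep unit[OF that] that j by (cases "i = j") auto
  define r where "r = sqrt (4000 * real d)"
  define X where "X g = (\<Sum>i<n. pm_sgn (dot d g (v i)))" for g
  define Y where "Y g = sin (r * dot d g (v j))" for g
  define S where "S T g = (\<Sum>i<n. sgn (dot d g (v i)) * Si (T * \<bar>dot d g (v i)\<bar>))" for T g
  have [measurable]: "pm_sgn \<in> borel_measurable borel"
    unfolding pm_sgn_def[abs_def] by measurable
  have [measurable]: "X \<in> borel_measurable (std_gaussian d)" "Y \<in> borel_measurable (std_gaussian d)"
    "S T \<in> borel_measurable (std_gaussian d)" for T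
    unfolding X_def[abs_def] Y_def[abs_def] S_def[abs_def] by measurable
  have Y1: "\<bar>Y g\<bar> \<le> 1" for g by (simp add: Y_def)
  have X_le: "\<bar>X g\<bar> \<le> real n" for g
    unfolding X_def by (rule order_trans[OF sum_abs]) (simp add: pm_sgn_def if_distrib cong: if_cong)
  have XY_le: "\<bar>X g * Y g\<bar> \<le> \<bar>X g\<bar>" for g
    using mult_left_mono[OF Y1[of g], of "\<bar>X g\<bar>"] by (simp add: abs_mult)
  obtain B where B: "\<bar>Si t\<bar> \<le> B" for t using bounded_Si by blast
  have S_le: "\<bar>S T g\<bar> \<le> real n * B" for T g
  proof -
    have "\<bar>sgn x * Si y\<bar> \<le> 1 * B" for x y :: real
      unfolding abs_mult using B[of y] by (intro mult_mono) (auto simp: sgn_if)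
    then have "(\<Sum>i<n. \<bar>sgn (dot d g (v i)) * Si (T * \<bar>dot d g (v i)\<bar>)\<bar>) \<le> (\<Sum>i<n. B)"
      by (intro sum_mono) simp
    then show ?thesis unfolding S_def by (intro order_trans[OF sum_abs]) simp
  qed
  \<comment> \<open>The cut-off is removed along \<open>T = k\<close> by dominated convergence, with
    boundedness of \<open>Si\<close> giving a constant majorant. \<open>sgn\<close> and
    \<open>pm_sgn\<close> differ only at 0, which almost surely is never hit.\<close>
  have "(\<lambda>k. expectation (\<lambda>g. S (real k) g * Y g)) \<longlonglongrightarrow> expectation (\<lambda>g. pi / 2 * X g * Y g)"
  proof (rule integral_dominated_convergence)
    show "AE g in std_gaussian d. norm (S (real k) g * Y g) \<le> real n * B" for k
    proof (rule AE_I2)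
      fix g
      have "\<bar>S (real k) g\<bar> * \<bar>Y g\<bar> \<le> real n * B * 1"
        using S_le Y1 order_trans[OF abs_ge_zero S_le] by (intro mult_mono) auto
      then show "norm (S (real k) g * Y g) \<le> real n * B" by (simp add: abs_mult)
    qed
    have "AE g in std_gaussian d. \<forall>i\<in>{..<n}. dot d g (v i) \<noteq> 0"
      by (rule AE_finite_allI) (auto intro: AE_dot_neq_0 unit)
    then show "AE g in std_gaussian d. (\<lambda>k. S (real k) g * Y g) \<longlonglongrightarrow> pi / 2 * X g * Y g"
    proof eventually_elim
      fix g assume nz: "\<forall>i\<in>{..<n}. dot d g (v i) \<noteq> 0"
      have "(\<lambda>k. sgn x * Si (real k * \<bar>x\<bar>)) \<longlonglongrightarrow> pm_sgn x * (pi / 2)" if "x \<noteq> 0" for x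
      proof -
        have "filterlim (\<lambda>k. real k * \<bar>x\<bar>) at_top sequentially"
          using that by (intro filterlim_at_top_mult_tendsto_pos[OF tendsto_const] filterlim_real_sequentially) auto
        from filterlim_compose[OF Si_at_top this] show ?thesis
          unfolding pm_sgn_eq_sgn[OF that] by (intro tendsto_mult tendsto_const)
      qed
      then have "(\<lambda>k. S (real k) g) \<longlonglongrightarrow> (\<Sum>i<n. pm_sgn (dot d g (v i)) * (pi / 2))"
        unfolding S_def using nz by (intro tendsto_sum) auto
      then show "(\<lambda>k. S (real k) g * Y g) \<longlonglongrightarrow> pi / 2 * X g * Y g"
        unfolding X_def by (intro tendsto_mult tendsto_const) (simp add: sum_distrib_left mult.commute)
    qed
  qed auto
  moreover have "\<forall>\<^sub>F k in sequentially. real n * exp (- (2000 * real d)) \<le> expectation (\<lambda>g. S (real k) g * Y g)"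
    using eventually_gt_at_top[of "nat \<lceil>3 / 2 * r\<rceil>"]
  proof eventually_elim
    fix k assume "nat \<lceil>3 / 2 * r\<rceil> < k"
    then have "3 / 2 * r < real k" by linarith
    then show "real n * exp (- (2000 * real d)) \<le> expectation (\<lambda>g. S (real k) g * Y g)"
      unfolding S_def Y_def by (intro integral_Si_sin_ge d j r_def unit t m)
  qed
  ultimately have "real n * exp (- (2000 * real d)) \<le> expectation (\<lambda>g. pi / 2 * X g * Y g)"
    by (intro tendsto_lowerbound) auto
  also have "\<dots> = pi / 2 * expectation (\<lambda>g. X g * Y g)"
    by (simp add: mult.assoc)
  finally have pos: "real n * exp (- (2000 * real d)) \<le> pi / 2 * expectation (\<lambda>g. X g * Y g)" .
  \<comment> \<open>Nonnegativity allows \<open>pi / 2\<close> to be replaced by the larger constant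
    2.\<close>
  then have "0 \<le> expectation (\<lambda>g. X g * Y g)"
    by (smt (verit) exp_gt_zero mult_nonneg_nonneg mult_pos_neg of_nat_0_le_iff pi_half_gt_zero)
  then have "pi / 2 * expectation (\<lambda>g. X g * Y g) \<le> 2 * expectation (\<lambda>g. X g * Y g)"
    using pi_less_4 by (intro mult_right_mono) auto
  with pos have ge: "real n * exp (- (2000 * real d)) / 2 \<le> expectation (\<lambda>g. X g * Y g)" by linarith
  \<comment> \<open>The constant 8004 must absorb the exponent \<open>4000 * d\<close> and the
    factor 1/4 left by squaring. Already \<open>ln 2 \<ge> 2 / 3\<close> gives
    \<open>5336 * d \<ge> 4000 * d + 2\<close>, and \<open>exp 2 \<ge> 4\<close>.\<close>
  have "2 powr (- (8004 * real d)) = exp (- (8004 * real d * ln 2))"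
    by (simp add: powr_def)
  also have "\<dots> \<le> exp (- (4000 * real d) - 2)"
  proof -
    have "8004 * real d * (2 / 3) \<le> 8004 * real d * ln 2"
      using ln2_ge_two_thirds by (intro mult_left_mono) auto
    moreover have "real d \<ge> 1" using d by simp
    ultimately have "- (8004 * real d * ln 2) \<le> - (4000 * real d) - 2" by linarith
    then show ?thesis by (simp only: exp_le_cancel_iff)
  qed
  also have "\<dots> \<le> exp (- (4000 * real d)) / 4"
  proof -
    have "(2 :: real) * 2 \<le> exp 1 * exp 1"
      using exp_ge_add_one_self[of 1] by (intro mult_mono) auto
    then have "4 \<le> exp (2 :: real)" by (simp flip: exp_add)
    then show ?thesis unfolding exp_diff by (intro divide_left_mono) auto
  qed
  finally have "(real n)\<^sup>2 * 2 powr (- (8004 * real d)) \<le> (real n)\<^sup>2 * (exp (- (4000 * real d)) / 4)"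
    by (rule mult_left_mono) simp
  also have "\<dots> = (real n * exp (- (2000 * real d)) / 2)\<^sup>2"
    by (simp add: power_mult_distrib power_divide flip: exp_of_nat_mult)
  also have "\<dots> \<le> (expectation (\<lambda>g. X g * Y g))\<^sup>2"
    using ge by (intro power_mono) auto
  \<comment> \<open>Nonnegativity of the variance of \<open>X * Y\<close>, followed by
    \<open>\<bar>Y\<bar> \<le> 1\<close>, removes the test function.\<close>
  also have "\<dots> \<le> expectation (\<lambda>g. (X g * Y g)\<^sup>2)"
    using order_trans[OF XY_le X_le] by (intro expectation_square_le prob_space_std_gaussian) auto
  also have "\<dots> \<le> expectation (\<lambda>g. (X g)\<^sup>2)"
  proof (rule integral_mono)
    show "integrable (std_gaussian d) (\<lambda>g. (X g)\<^sup>2)"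
      using X_le by (intro integrable_const_bound[where B="(real n)\<^sup>2"]) (auto simp flip: abs_le_square_iff)
    show "integrable (std_gaussian d) (\<lambda>g. (X g * Y g)\<^sup>2)"
      using order_trans[OF XY_le X_le]
      by (intro integrable_const_bound[where B="(real n)\<^sup>2"]) (auto simp flip: abs_le_square_iff)
    show "(X g * Y g)\<^sup>2 \<le> (X g)\<^sup>2" for g
      using XY_le by (simp flip: abs_le_square_iff)
  qed
  finally show "(real n)\<^sup>2 * 2 powr (- (8004 * real d)) \<le>
    expectation (\<lambda>g. (\<Sum>i<n. pm_sgn (dot d g (v i)))\<^sup>2)"
    unfolding X_def .
qed simp

end
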